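(* Let $j\ge 0$ and $k$ be integers with $2^j\le k\le 2^{j+1}$. Then $$b_k=a_{2^{j+1}-k}\,a_{k-2^j}.$$
   Context: Stern's diatomic sequence $(a_n)_{n\ge 0}$ is defined by $a_0=0$, $a_1=1$, $a_{2n}=a_n$, $a_{2n+1}=a_n+a_{n+1}$ for $n\ge1$. For non-negative reals $x,y$ let $x\oplus y:=x+y+\sqrt{4xy+1}$. The sequence $(b_n)_{n\ge1}$ of non-negative reals is defined by $b_1=0$ and, for $n\ge 1$, $b_{2n}=b_n$, $b_{2n+1}=b_n\oplus b_{n+1}$. *)

theory Defs
  imports Complex_Main
begin

function stern :: "nat \<Rightarrow> nat" where
  "stern n = (if n = 0 then 0 else if n = 1 then 1
     else if even n then stern (n div 2)
     else stern (n div 2) + stern (n div 2 + 1))"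
  by pat_completeness auto
termination
  by (relation "measure id") (auto elim!: oddE)

declare stern.simps [simp del]

definition oplus :: "real \<Rightarrow> real \<Rightarrow> real" where
  "oplus x y = x + y + sqrt (4 * x * y + 1)"

(* The sequence is indexed from 1; the value 0 at index 0 is a dummy, never
   reached by the recursion from a positive index. *)
function b_seq :: "nat \<Rightarrow> real" where
  "b_seq n = (if n = 0 then 0 else if n = 1 then 0
     else if even n then b_seq (n div 2)
     else oplus (b_seq (n div 2)) (b_seq (n div 2 + 1)))"
  by pat_completeness auto
termination
  by (relation "measure id") (auto elim!: oddE)

declare b_seq.simps [simp del]

lemma stern_0: "stern 0 = 0"
  and stern_1: "stern 1 = 1"
  by (simp_all add: stern.simps)

lemma stern_even: "n \<ge> 1 \<Longrightarrow> stern (2 * n) = stern n"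
  and stern_odd: "n \<ge> 1 \<Longrightarrow> stern (2 * n + 1) = stern n + stern (n + 1)"
  by (subst stern.simps, simp)+

lemma b_seq_1: "b_seq 1 = 0"
  by (simp add: b_seq.simps)

lemma b_seq_even: "n \<ge> 1 \<Longrightarrow> b_seq (2 * n) = b_seq n"
  and b_seq_odd: "n \<ge> 1 \<Longrightarrow> b_seq (2 * n + 1) = oplus (b_seq n) (b_seq (n + 1))"
  by (subst b_seq.simps, simp)+

lemma b_seq_nonneg: "b_seq n \<ge> 0"
proof (induction n rule: b_seq.induct)
  case (1 n)
  then show ?case
    by (subst b_seq.simps) (auto simp: oplus_def)
qed

end

theory Submission
  imports Defs
begin

text \<open>
  Put \<open>m = k - 2^j\<close> and \<open>n = 2^(j+1) - k\<close>, so that \<open>m + n = 2^j\<close> and the claim reads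
  \<open>b (2^j + m) = a m * a n\<close>. Halving preserves this shape, and the only nontrivial step, odd \<open>m\<close>,
  rests on the identity \<open>a (m+1) * a (n+1) - a m * a n = 1\<close> for \<open>m + n + 1 = 2^j\<close>: it
  makes the radicand in \<open>oplus\<close> the square of \<open>a (m+1) * a (n+1) + a m * a n\<close>.
\<close>

lemma stern_double: "stern (2 * n) = stern n"
  by (cases "n = 0") (simp_all add: stern_even)

text \<open>As \<open>stern 0 = 0\<close>, the odd recurrence persists at index 0, so the inductions
  below need no separate case for zero halves.\<close>

lemma stern_double_Suc: "stern (Suc (2 * n)) = stern n + stern (Suc n)"
  using stern_odd[of n] by (cases "n = 0") (simp_all add: stern_0 stern_1[simplified])

lemma stern_determinant:
  assumes "m + n + 1 = 2 ^ j"
  shows "stern (Suc m) * stern (Suc n) = stern m * stern n + 1"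
  using assms
proof (induction j arbitrary: m n)
  case 0
  then show ?case by (simp add: stern_0 stern_1[simplified])
next
  case (Suc j)
  \<comment> \<open>As m + n is odd, one of them is 2p and the other 2q + 1; the identity is
    symmetric in them. After expansion both sides share \<open>stern p * stern (Suc q)\<close>, and
    what remains is the identity for p and q.\<close>
  have step: "stern (Suc (2 * p)) * stern (Suc (Suc (2 * q)))
      = stern (2 * p) * stern (Suc (2 * q)) + 1"
    if "p + q + 1 = 2 ^ j" for p q
  proof -
    have "stern (Suc (2 * p)) * stern (Suc (Suc (2 * q)))
        = stern p * stern (Suc q) + stern (Suc p) * stern (Suc q)"
      using stern_double[of "Suc q"] by (simp add: stern_double_Suc distrib_right)
    then show ?thesis
      using Suc.IH[OF that] by (simp add: stern_double stern_double_Suc distrib_left)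
  qed
  show ?case
  proof (cases "even m")
    case True
    then obtain p where p: "m = 2 * p" by blast
    with Suc.prems have "odd n" by (metis even_Suc even_add even_mult_iff even_numeral
        Suc_eq_plus1 power_Suc)
    then obtain q where q: "n = Suc (2 * q)" by (metis oddE Suc_eq_plus1)
    show ?thesis using step[of p q] Suc.prems p q by simp
  next
    case False
    then obtain p where p: "m = Suc (2 * p)" by (metis oddE Suc_eq_plus1)
    with Suc.prems have "even n" by (metis even_Suc even_add even_mult_iff even_numeral
        Suc_eq_plus1 power_Suc)
    then obtain q where q: "n = 2 * q" by blast
    show ?thesis using step[of q p] Suc.prems p q by (simp add: mult.commute)
  qed
qed

text \<open>With t = x * y, the cross products multiply to t * (t + 1), and 4t(t + 1) + 1 = (2t +
  1)^2. The root then supplies the two products missing from the expansion of the right-hand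
  side.\<close>

lemma oplus_products:
  fixes x x' y y' :: real
  assumes "x' * y' = x * y + 1" "x * y \<ge> 0"
  shows "oplus (x * y') (x' * y) = (x + x') * (y + y')"
proof -
  have "4 * (x * y') * (x' * y) + 1 = 4 * (x * y) * (x' * y') + 1" by (simp add: ac_simps)
  also have "\<dots> = (x' * y' + x * y)\<^sup>2"
    unfolding assms(1) by (simp add: power2_eq_square algebra_simps)
  finally have "sqrt (4 * (x * y') * (x' * y) + 1) = x' * y' + x * y"
    using assms by simp
  then show ?thesis by (simp add: oplus_def algebra_simps)
qed

lemma b_seq_stern:
  assumes "m + n = 2 ^ j"
  shows "b_seq (2 ^ j + m) = real (stern m * stern n)"
  using assms
proof (induction j arbitrary: m n)
  case 0
  then have "m = 0 \<or> m = 1" by auto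
  \<comment> \<open>The indices are 1 and 2, where \<open>b_seq\<close> vanishes, and one factor on
    the right is \<open>stern 0\<close>.\<close>
  then show ?case
    using b_seq_1 b_seq_even[of 1] 0 by (auto simp: stern_0 numeral_2_eq_2)
next
  case (Suc j)
  show ?case
  proof (cases "even m")
    case True
    with Suc.prems have "even n" by (metis even_add even_mult_iff even_numeral power_Suc)
    with True obtain p q where pq: "m = 2 * p" "n = 2 * q" by blast
    then have "b_seq (2 ^ j + p) = real (stern p * stern q)"
      using Suc by simp
    with pq b_seq_even[of "2 ^ j + p"] show ?thesis
      by (simp add: stern_double Suc_le_eq)
  next
    case False
    with Suc.prems have "odd n" by (metis even_add even_mult_iff even_numeral power_Suc)
    with False obtain p q where pq: "m = Suc (2 * p)" "n = Suc (2 * q)"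
      by (metis oddE Suc_eq_plus1)
    then have sum: "p + q + 1 = 2 ^ j" using Suc.prems by simp
    \<comment> \<open>The two neighbours belong to the pairs (p, q + 1) and (p + 1, q), both of sum
      2^j, so the induction hypothesis turns them into cross products.\<close>
    have "b_seq (2 ^ Suc j + m) = oplus (b_seq (2 ^ j + p)) (b_seq (2 ^ j + Suc p))"
      using b_seq_odd[of "2 ^ j + p"] pq by (simp add: Suc_le_eq)
    also have "\<dots> = oplus (real (stern p) * real (stern (Suc q)))
        (real (stern (Suc p)) * real (stern q))"
      using Suc.IH[of p "Suc q"] Suc.IH[of "Suc p" q] sum by simp
    also have "\<dots> = (real (stern p) + real (stern (Suc p)))
        * (real (stern q) + real (stern (Suc q)))"
    proof (rule oplus_products)
      show "real (stern (Suc p)) * real (stern (Suc q))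
          = real (stern p) * real (stern q) + 1"
        using arg_cong[OF stern_determinant[OF sum], of real] by simp
    qed simp
    finally show ?thesis using pq by (simp add: stern_double_Suc)
  qed
qed

theorem theorem3p6:
  fixes j k :: nat
  assumes "2 ^ j \<le> k" and "k \<le> 2 ^ (j + 1)"
  shows "b_seq k = real (stern (2 ^ (j + 1) - k) * stern (k - 2 ^ j))"
  using b_seq_stern[of "k - 2 ^ j" "2 ^ (j + 1) - k" j] assms
  by (simp add: mult.commute)

end
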